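(* Let $n\ge 1$ and consider an inequality in canonical form over $H_n$, $$\sum_{l=1}^{L}\alpha_l S_{I_l}\ \ge\ \sum_{r=1}^{R}\beta_r S_{J_r},\qquad (\ast)$$ where all $\alpha_l,\beta_r>0$, the sets $I_1,\dots,I_L,J_1,\dots,J_R\subseteq[n]$ are distinct and non-empty, and every $i\in[n]$ belongs to at least one of them. The inequality $(\ast)$ is valid for $H_n$ if there exists a $d_\alpha$-$d_\beta$ contraction map $$f: A_n(\mathcal{I}_L)\to \{0,1\}^R$$ satisfying $f(x^{(i)})=y^{(i)}$ for all $i\in[n]\cup\{N\}$.
   Context: For a positive integer $k$ let $[k]=\{1,\dots,k\}$. $K_N$ is the undirected complete graph on vertex set $[N]$, with edge set $E_N$. A weight map is a function $w:E_N\to\mathbb{R}_{\ge 0}$. For $W\subseteq[N]$, the cut $C(W)$ is the set of edges with exactly one endpoint in $W$, and $\|C(W)\|$ is the sum of the weights of its edges. For $n<N$, $w$ realizes in $K_N$ the vector $S=(S_I)_{\varnothing\ne I\subseteq[n]}\in\mathbb{R}^{2^n-1}$ with $S_I=\min\{\|C(W)\| : W\subseteq[N-1],\ W\cap[n]=I\}$. $H_n$ is the set of all $S\in\mathbb{R}^{2^n-1}$ realized by some weight map in $K_N$ for some $N>n$. An inequality is valid for $H_n$ if it is satisfied by all $S\in H_n$. The symbol $N$ also denotes the sink label, which is not an element of $[n]$. Distances: for $\gamma\in\mathbb{R}^m$ with positive entries and $x,x'\in\{0,1\}^m$, $d_\gamma(x,x')=\sum_{k=1}^m\gamma_k|x_k-x'_k|$.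 A map $f$ from a subset of $\{0,1\}^L$ to $\{0,1\}^R$ is a $d_\alpha$-$d_\beta$ contraction map if $d_\beta(f(x),f(x'))\le d_\alpha(x,x')$ for all $x,x'$ in its domain, where $\alpha=(\alpha_1,\dots,\alpha_L)$, $\beta=(\beta_1,\dots,\beta_R)$. Occurrence vectors: for $i\in[n]\cup\{N\}$, $x^{(i)}\in\{0,1\}^L$ has $x^{(i)}_l=1$ if $i\in I_l$ and $0$ otherwise; $y^{(i)}\in\{0,1\}^R$ has $y^{(i)}_r=1$ if $i\in J_r$ and $0$ otherwise. In particular $x^{(N)}$ and $y^{(N)}$ are all-zero. The domain: let $\mathcal{I}_L=\{I_1,\dots,I_L\}$ and, for $x\in\{0,1\}^L$, $\mathcal{I}(x)=\{I_l : x_l=1\}$. $A_n(\mathcal{I}_L)$ is the set of $x\in\{0,1\}^L$ such that $\mathcal{I}(x)$ is pairwise intersecting (any two members have non-empty intersection; the empty family and one-element families count as pairwise intersecting) and is an upper set in $\mathcal{I}_L$ (if $I_l\in\mathcal{I}(x)$ and $I_l\subseteq I_k$ with $k\in[L]$, then $I_k\in\mathcal{I}(x)$). Equivalently, such $x$ correspond to pairwise intersecting antichains in $\mathcal{I}_L$, given by the minimal elements of $\mathcal{I}(x)$. *)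

theory Defs
  imports Complex_Main "HOL-Library.FuncSet"
begin

definition edges :: "nat \<Rightarrow> nat set set" where
  "edges N = {e. e \<subseteq> {1..N} \<and> card e = 2}"

text \<open>Only the values of a weight map on \<open>edges N\<close> are constrained and used.\<close>

definition weight_map :: "nat \<Rightarrow> (nat set \<Rightarrow> real) \<Rightarrow> bool" where
  "weight_map N w \<longleftrightarrow> w \<in> edges N \<rightarrow> {0..}"

definition cut :: "nat \<Rightarrow> nat set \<Rightarrow> nat set set" where
  "cut N W = {e \<in> edges N. card (e \<inter> W) = 1}"

definition cut_weight :: "nat \<Rightarrow> (nat set \<Rightarrow> real) \<Rightarrow> nat set \<Rightarrow> real" where
  "cut_weight N w W = (\<Sum>e\<in>cut N W. w e)"

text \<open>A vector with \<open>2 ^ n - 1\<close> real entries is an extensional function on the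
  non-empty subsets of \<open>{1..n}\<close>.\<close>

definition subsystems :: "nat \<Rightarrow> nat set set" where
  "subsystems n = {I. I \<noteq> {} \<and> I \<subseteq> {1..n}}"

text \<open>The vertex \<open>N\<close> is the sink and lies in no admissible \<open>W\<close>. For \<open>n < N\<close> and
  \<open>I \<subseteq> {1..n}\<close> the minimum is over a finite non-empty set.\<close>

definition realizes :: "nat \<Rightarrow> nat \<Rightarrow> (nat set \<Rightarrow> real) \<Rightarrow> (nat set \<Rightarrow> real) \<Rightarrow> bool" where
  "realizes n N w S \<longleftrightarrow>
     S = (\<lambda>I\<in>subsystems n. Min {cut_weight N w W | W. W \<subseteq> {1..N - 1} \<and> W \<inter> {1..n} = I})"

definition H :: "nat \<Rightarrow> (nat set \<Rightarrow> real) set" where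
  "H n = {S. \<exists>N w. n < N \<and> weight_map N w \<and> realizes n N w S}"

definition valid_for_H :: "nat \<Rightarrow> ((nat set \<Rightarrow> real) \<Rightarrow> bool) \<Rightarrow> bool" where
  "valid_for_H n P \<longleftrightarrow> (\<forall>S\<in>H n. P S)"

definition bits :: "nat \<Rightarrow> (nat \<Rightarrow> real) set" where
  "bits m = {1..m} \<rightarrow>\<^sub>E {0, 1}"

definition wdist :: "nat \<Rightarrow> (nat \<Rightarrow> real) \<Rightarrow> (nat \<Rightarrow> real) \<Rightarrow> (nat \<Rightarrow> real) \<Rightarrow> real" where
  "wdist m \<gamma> x x' = (\<Sum>k=1..m. \<gamma> k * \<bar>x k - x' k\<bar>)"

definition contraction_map ::
  "nat \<Rightarrow> (nat \<Rightarrow> real) \<Rightarrow> nat \<Rightarrow> (nat \<Rightarrow> real) \<Rightarrow> (nat \<Rightarrow> real) set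
    \<Rightarrow> ((nat \<Rightarrow> real) \<Rightarrow> nat \<Rightarrow> real) \<Rightarrow> bool" where
  "contraction_map L \<alpha> R \<beta> D f \<longleftrightarrow>
     D \<subseteq> bits L \<and> f \<in> D \<rightarrow> bits R \<and>
     (\<forall>x\<in>D. \<forall>x'\<in>D. wdist R \<beta> (f x) (f x') \<le> wdist L \<alpha> x x')"

definition occurrence :: "nat \<Rightarrow> (nat \<Rightarrow> nat set) \<Rightarrow> nat \<Rightarrow> nat \<Rightarrow> real" where
  "occurrence m I i = (\<lambda>k\<in>{1..m}. if i \<in> I k then 1 else 0)"

definition family_of :: "nat \<Rightarrow> (nat \<Rightarrow> nat set) \<Rightarrow> (nat \<Rightarrow> real) \<Rightarrow> nat set set" where
  "family_of L I x = {I l | l. l \<in> {1..L} \<and> x l = 1}"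

text \<open>\<open>pairwise\<close> quantifies over distinct members only, so one-element families count as
  pairwise intersecting.\<close>

definition A_dom :: "nat \<Rightarrow> (nat \<Rightarrow> nat set) \<Rightarrow> (nat \<Rightarrow> real) set" where
  "A_dom L I = {x \<in> bits L.
     pairwise (\<lambda>A B. A \<inter> B \<noteq> {}) (family_of L I x) \<and>
     (\<forall>A\<in>family_of L I x. \<forall>k\<in>{1..L}. A \<subseteq> I k \<longrightarrow> I k \<in> family_of L I x)}"

end

theory Submission
  imports Defs
begin

text \<open>Choose for every subsystem \<open>A\<close> a minimum cut \<open>V A\<close> with as few vertices as possible. By sub-
  and posimodularity of the cut function, \<open>V\<close> preserves inclusions and disjointness, so recording
  the sets \<open>V (I l)\<close> that contain a given vertex yields a point of \<open>A_dom L I\<close>. Applying the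
  contraction to these points labels every vertex by a bit vector, and the \<open>r\<close>-th bits describe a
  cut for \<open>J r\<close>. Summed over the edges, the contraction property bounds the weighted sum of
  these cuts by that of the minimum cuts \<open>V (I l)\<close>.\<close>

section \<open>Cut weights, submodularity and posimodularity\<close>

lemma finite_edges: "finite (edges M)"
  by (rule finite_subset[of _ "Pow {1..M}"]) (auto simp: edges_def)

lemma card_pair_Int_eq_1:
  assumes "u \<noteq> v"
  shows "card ({u, v} \<inter> W) = 1 \<longleftrightarrow> (u \<in> W) \<noteq> (v \<in> W)"
  using assms by (cases "u \<in> W"; cases "v \<in> W") (auto simp: Int_insert_left)

lemma edgesE:
  assumes "e \<in> edges M"
  obtains u v where "e = {u, v}" "u \<noteq> v" "u \<in> {1..M}" "v \<in> {1..M}"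
  using assms unfolding edges_def card_2_iff by auto

lemma weight_map_nonneg: "weight_map M w \<Longrightarrow> e \<in> edges M \<Longrightarrow> 0 \<le> w e"
  by (auto simp: weight_map_def)

text \<open>With one index set for all cuts, an inequality between cut weights can be checked
  separately for each edge.\<close>

lemma cut_weight_eq_sum_edges:
  "cut_weight M w W = (\<Sum>e\<in>edges M. w e * of_bool (card (e \<inter> W) = 1))"
  unfolding cut_weight_def cut_def
  by (auto simp: finite_edges intro!: sum.mono_neutral_cong_left)

text \<open>Holds edge by edge, by cases on where the two endpoints lie. An edge between
  \<open>A - B\<close> and \<open>B - A\<close> is counted twice on the right and not at all on the
  left.\<close>

lemma cut_weight_submodular:
  assumes "weight_map M w"
  shows "cut_weight M w (A \<inter> B) + cut_weight M w (A \<union> B) \<le> cut_weight M w A + cut_weight M w B"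
  unfolding cut_weight_eq_sum_edges sum.distrib[symmetric] distrib_left[symmetric]
proof (intro sum_mono mult_left_mono)
  fix e assume e: "e \<in> edges M"
  then obtain u v where uv: "e = {u, v}" "u \<noteq> v" by (rule edgesE)
  show "of_bool (card (e \<inter> (A \<inter> B)) = 1) + of_bool (card (e \<inter> (A \<union> B)) = 1)
      \<le> of_bool (card (e \<inter> A) = 1) + (of_bool (card (e \<inter> B) = 1) :: real)"
    unfolding uv(1) card_pair_Int_eq_1[OF uv(2)]
    by (cases "u \<in> A"; cases "u \<in> B"; cases "v \<in> A"; cases "v \<in> B") simp_all
  show "0 \<le> w e" using assms e by (rule weight_map_nonneg)
qed

text \<open>This is submodularity with \<open>B\<close> replaced by its complement, since undirected
  cuts do not distinguish a set from its complement. Here the edges between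
  \<open>A \<inter> B\<close> and the outside of \<open>A \<union> B\<close> are the ones lost on
  the left.\<close>

lemma cut_weight_posimodular:
  assumes "weight_map M w"
  shows "cut_weight M w (A - B) + cut_weight M w (B - A) \<le> cut_weight M w A + cut_weight M w B"
  unfolding cut_weight_eq_sum_edges sum.distrib[symmetric] distrib_left[symmetric]
proof (intro sum_mono mult_left_mono)
  fix e assume e: "e \<in> edges M"
  then obtain u v where uv: "e = {u, v}" "u \<noteq> v" by (rule edgesE)
  show "of_bool (card (e \<inter> (A - B)) = 1) + of_bool (card (e \<inter> (B - A)) = 1)
      \<le> of_bool (card (e \<inter> A) = 1) + (of_bool (card (e \<inter> B) = 1) :: real)"
    unfolding uv(1) card_pair_Int_eq_1[OF uv(2)]
    by (cases "u \<in> A"; cases "u \<in> B"; cases "v \<in> A"; cases "v \<in> B") simp_all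
  show "0 \<le> w e" using assms e by (rule weight_map_nonneg)
qed

section \<open>Minimum cuts with fewest vertices\<close>

definition cut_sets :: "nat \<Rightarrow> nat \<Rightarrow> nat set \<Rightarrow> nat set set" where
  "cut_sets M n A = {W. W \<subseteq> {1..M - 1} \<and> W \<inter> {1..n} = A}"

lemma finite_cut_sets: "finite (cut_sets M n A)"
  by (rule finite_subset[of _ "Pow {1..M - 1}"]) (auto simp: cut_sets_def)

lemma self_in_cut_sets: "n < M \<Longrightarrow> A \<subseteq> {1..n} \<Longrightarrow> A \<in> cut_sets M n A"
  unfolding cut_sets_def by force

lemma finite_cut_sets_imp_finite: "W \<in> cut_sets M n A \<Longrightarrow> finite W"
  by (auto simp: cut_sets_def intro: finite_subset)

definition is_min_cut :: "nat \<Rightarrow> nat \<Rightarrow> (nat set \<Rightarrow> real) \<Rightarrow> nat set \<Rightarrow> nat set \<Rightarrow> bool" where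
  "is_min_cut M n w A W \<longleftrightarrow>
     W \<in> cut_sets M n A \<and> (\<forall>W'\<in>cut_sets M n A. cut_weight M w W \<le> cut_weight M w W')"

lemma ex_min_cut:
  assumes "n < M" "A \<subseteq> {1..n}"
  shows "\<exists>W. is_min_cut M n w A W"
  using ex_min_if_finite[of "cut_weight M w ` cut_sets M n A"] self_in_cut_sets[OF assms]
  by (fastforce simp: is_min_cut_def finite_cut_sets not_less)

text \<open>The tie-break by \<open>card\<close> matters: arbitrary minimum cuts of nested
  subsystems need not be nested, and those of disjoint subsystems need not be disjoint.\<close>

definition least_min_cut :: "nat \<Rightarrow> nat \<Rightarrow> (nat set \<Rightarrow> real) \<Rightarrow> nat set \<Rightarrow> nat set" where
  "least_min_cut M n w A = arg_min card (is_min_cut M n w A)"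

lemma least_min_cut_is_min_cut:
  assumes "n < M" "A \<subseteq> {1..n}"
  shows "is_min_cut M n w A (least_min_cut M n w A)"
  unfolding least_min_cut_def using ex_min_cut[OF assms] by (auto intro: arg_min_natI)

text \<open>Such a \<open>W\<close> is itself a minimum cut, so it has at least as many vertices as
  the finite set that contains it.\<close>

lemma least_min_cut_subset:
  assumes "n < M" "A \<subseteq> {1..n}"
    and "W \<subseteq> least_min_cut M n w A" "W \<in> cut_sets M n A"
    and "cut_weight M w W \<le> cut_weight M w (least_min_cut M n w A)"
  shows "least_min_cut M n w A = W"
proof -
  let ?V = "least_min_cut M n w A"
  have V: "is_min_cut M n w A ?V" using assms(1,2) by (rule least_min_cut_is_min_cut)
  with assms(4,5) have "is_min_cut M n w A W"
    by (force simp: is_min_cut_def)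
  then have "card ?V \<le> card W"
    unfolding least_min_cut_def by (rule arg_min_nat_le)
  moreover have "finite ?V" using V finite_cut_sets_imp_finite by (auto simp: is_min_cut_def)
  ultimately show ?thesis using assms(3) by (metis card_seteq)
qed

text \<open>Uncrossing: the union of the two cuts competes for \<open>B\<close>, so it weighs at
  least as much as the minimum cut of \<open>B\<close>. Submodularity then makes the intersection,
  which competes for \<open>A\<close>, no heavier than the minimum cut of \<open>A\<close>, and the
  tie-break forces equality.\<close>

lemma least_min_cut_mono:
  assumes "weight_map M w" "n < M" "A \<subseteq> B" "B \<subseteq> {1..n}"
  shows "least_min_cut M n w A \<subseteq> least_min_cut M n w B"
proof -
  let ?V = "least_min_cut M n w A" and ?W = "least_min_cut M n w B"
  have A: "A \<subseteq> {1..n}" using assms by auto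
  have V: "is_min_cut M n w A ?V" and W: "is_min_cut M n w B ?W"
    using least_min_cut_is_min_cut assms A by auto
  have "?V \<inter> ?W \<in> cut_sets M n A" "?V \<union> ?W \<in> cut_sets M n B"
    using V W assms(3) unfolding is_min_cut_def cut_sets_def by blast+
  moreover from this have "cut_weight M w (?V \<inter> ?W) \<le> cut_weight M w ?V"
    using cut_weight_submodular[OF assms(1), of ?V ?W] W by (force simp: is_min_cut_def)
  ultimately have "?V = ?V \<inter> ?W"
    using least_min_cut_subset[OF assms(2) A] by blast
  then show ?thesis by blast
qed

text \<open>The same uncrossing with differences in place of intersection and union. As
  \<open>A\<close> and \<open>B\<close> are disjoint, removing one cut from the other does not
  change its trace on \<open>{1..n}\<close>.\<close>

lemma least_min_cut_disjoint:
  assumes "weight_map M w" "n < M" "A \<subseteq> {1..n}" "B \<subseteq> {1..n}" "A \<inter> B = {}"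
  shows "least_min_cut M n w A \<inter> least_min_cut M n w B = {}"
proof -
  let ?V = "least_min_cut M n w A" and ?W = "least_min_cut M n w B"
  have V: "is_min_cut M n w A ?V" and W: "is_min_cut M n w B ?W"
    using least_min_cut_is_min_cut assms by auto
  have "?V - ?W \<in> cut_sets M n A" "?W - ?V \<in> cut_sets M n B"
    using V W assms(5) unfolding is_min_cut_def cut_sets_def by blast+
  moreover from this have "cut_weight M w (?V - ?W) \<le> cut_weight M w ?V"
    using cut_weight_posimodular[OF assms(1), of ?V ?W] W by (force simp: is_min_cut_def)
  ultimately have "?V = ?V - ?W"
    using least_min_cut_subset[OF assms(2,3)] by blast
  then show ?thesis by blast
qed

section \<open>Realized entries and occurrence vectors of vertices\<close>

lemma realizes_le_cut_weight:
  assumes "realizes n M w S" "A \<in> subsystems n" "W \<in> cut_sets M n A"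
  shows "S A \<le> cut_weight M w W"
proof -
  have "S A = Min (cut_weight M w ` cut_sets M n A)"
    using assms(1,2) by (auto simp: realizes_def cut_sets_def image_def intro!: arg_cong[of _ _ Min])
  then show ?thesis using assms(3) by (simp add: finite_cut_sets)
qed

lemma realizes_least_min_cut:
  assumes "realizes n M w S" "A \<in> subsystems n" "n < M"
  shows "S A = cut_weight M w (least_min_cut M n w A)"
proof -
  have "S A = Min (cut_weight M w ` cut_sets M n A)"
    using assms(1,2) by (auto simp: realizes_def cut_sets_def image_def intro!: arg_cong[of _ _ Min])
  moreover have "is_min_cut M n w A (least_min_cut M n w A)"
    using assms by (intro least_min_cut_is_min_cut) (auto simp: subsystems_def)
  ultimately show ?thesis
    by (auto simp: is_min_cut_def finite_cut_sets intro!: Min_eqI)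
qed

text \<open>The vector marks those \<open>I l\<close> for which \<open>v\<close> lies in
  \<open>W l\<close>. Two marked sets intersect, because otherwise \<open>v\<close> would lie in two
  disjoint sets \<open>W k\<close> and \<open>W l\<close>; monotonicity makes the marked family an
  upper set.\<close>

lemma occurrence_in_A_dom:
  assumes mono: "\<And>k l. k \<in> {1..L} \<Longrightarrow> l \<in> {1..L} \<Longrightarrow> I k \<subseteq> I l \<Longrightarrow> W k \<subseteq> W l"
    and disj: "\<And>k l. k \<in> {1..L} \<Longrightarrow> l \<in> {1..L} \<Longrightarrow> I k \<inter> I l = {} \<Longrightarrow> W k \<inter> W l = {}"
  shows "occurrence L W v \<in> A_dom L I"
proof -
  have fam: "family_of L I (occurrence L W v) = {I l |l. l \<in> {1..L} \<and> v \<in> W l}"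
    unfolding family_of_def occurrence_def by (intro Collect_cong ex_cong1) auto
  show ?thesis
    unfolding A_dom_def
  proof (rule CollectI, unfold fam, intro conjI ballI impI pairwiseI)
    show "occurrence L W v \<in> bits L"
      by (simp add: occurrence_def bits_def)
  next
    fix A B assume "A \<in> {I l |l. l \<in> {1..L} \<and> v \<in> W l}" "B \<in> {I l |l. l \<in> {1..L} \<and> v \<in> W l}"
    then show "A \<inter> B \<noteq> {}" using disj by blast
  next
    fix A k assume "A \<in> {I l |l. l \<in> {1..L} \<and> v \<in> W l}" "k \<in> {1..L}" "A \<subseteq> I k"
    then show "I k \<in> {I l |l. l \<in> {1..L} \<and> v \<in> W l}" using mono by blast
  qed
qed

text \<open>The link between distances and cuts: coordinate \<open>k\<close> contributes exactly
  when \<open>W k\<close> separates \<open>u\<close> from \<open>v\<close>.\<close>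

lemma wdist_occurrence_edge:
  assumes "u \<noteq> v"
  shows "wdist m \<gamma> (occurrence m W u) (occurrence m W v)
    = (\<Sum>k=1..m. \<gamma> k * of_bool (card ({u, v} \<inter> W k) = 1))"
  unfolding wdist_def using card_pair_Int_eq_1[OF assms]
  by (intro sum.cong) (auto simp: occurrence_def)

text \<open>After the exchange of sums, the factor of \<open>w e\<close> is the distance between the
  occurrence vectors of the endpoints of \<open>e\<close>.\<close>

lemma sum_cut_weight_eq:
  "(\<Sum>k=1..m. \<gamma> k * cut_weight M w (W k))
    = (\<Sum>e\<in>edges M. w e * (\<Sum>k=1..m. \<gamma> k * of_bool (card (e \<inter> W k) = 1)))"
proof -
  have "(\<Sum>k=1..m. \<gamma> k * cut_weight M w (W k))
      = (\<Sum>k=1..m. \<Sum>e\<in>edges M. w e * (\<gamma> k * of_bool (card (e \<inter> W k) = 1)))"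
    unfolding cut_weight_eq_sum_edges sum_distrib_left by (simp only: mult.left_commute)
  also have "\<dots> = (\<Sum>e\<in>edges M. \<Sum>k=1..m. w e * (\<gamma> k * of_bool (card (e \<inter> W k) = 1)))"
    by (rule sum.swap)
  finally show ?thesis by (simp only: sum_distrib_left)
qed

lemma sum_cut_weight_contraction:
  assumes "weight_map M w"
    and "\<And>u v. u \<in> {1..M} \<Longrightarrow> v \<in> {1..M} \<Longrightarrow>
      wdist R \<beta> (occurrence R U u) (occurrence R U v) \<le> wdist L \<alpha> (occurrence L W u) (occurrence L W v)"
  shows "(\<Sum>r=1..R. \<beta> r * cut_weight M w (U r)) \<le> (\<Sum>l=1..L. \<alpha> l * cut_weight M w (W l))"
  unfolding sum_cut_weight_eq
proof (intro sum_mono mult_left_mono)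
  fix e assume e: "e \<in> edges M"
  then obtain u v where uv: "e = {u, v}" "u \<noteq> v" "u \<in> {1..M}" "v \<in> {1..M}" by (rule edgesE)
  show "(\<Sum>r=1..R. \<beta> r * of_bool (card (e \<inter> U r) = 1))
      \<le> (\<Sum>l=1..L. \<alpha> l * of_bool (card (e \<inter> W l) = 1))"
    using assms(2)[OF uv(3,4)] unfolding uv(1) wdist_occurrence_edge[OF uv(2)] .
  show "0 \<le> w e" using assms(1) e by (rule weight_map_nonneg)
qed

lemma occurrence_cong:
  assumes "\<And>k. k \<in> {1..m} \<Longrightarrow> i \<in> A k \<longleftrightarrow> j \<in> B k"
  shows "occurrence m A i = occurrence m B j"
  unfolding occurrence_def using assms by (intro restrict_ext) auto

lemma bits_eq_occurrence:
  assumes "\<And>v. v \<in> X \<Longrightarrow> g v \<in> bits m" "v \<in> X"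
  shows "occurrence m (\<lambda>k. {v \<in> X. g v k = 1}) v = g v"
proof
  fix k
  show "occurrence m (\<lambda>k. {v \<in> X. g v k = 1}) v k = g v k"
    \<comment> \<open>Outside \<open>{1..m}\<close> both sides are \<open>undefined\<close>, as
      elements of \<open>bits m\<close> are extensional.\<close>
    using assms(1)[OF assms(2)] assms(2)
    by (cases "k \<in> {1..m}") (auto simp: occurrence_def bits_def PiE_def extensional_def)
qed

theorem theorem4:
  fixes n L R N :: nat
    and \<alpha> \<beta> :: "nat \<Rightarrow> real"
    and I J :: "nat \<Rightarrow> nat set"
  assumes "n \<ge> 1"
    and "\<forall>l\<in>{1..L}. \<alpha> l > 0"
    and "\<forall>r\<in>{1..R}. \<beta> r > 0"
    and "\<forall>l\<in>{1..L}. I l \<noteq> {} \<and> I l \<subseteq> {1..n}"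
    and "\<forall>r\<in>{1..R}. J r \<noteq> {} \<and> J r \<subseteq> {1..n}"
    and "inj_on I {1..L}"
    and "inj_on J {1..R}"
    and "I ` {1..L} \<inter> J ` {1..R} = {}"
    and "\<forall>i\<in>{1..n}. (\<exists>l\<in>{1..L}. i \<in> I l) \<or> (\<exists>r\<in>{1..R}. i \<in> J r)"
    and "N \<notin> {1..n}"
    and "\<exists>f. contraction_map L \<alpha> R \<beta> (A_dom L I) f \<and>
           (\<forall>i\<in>{1..n} \<union> {N}. f (occurrence L I i) = occurrence R J i)"
  shows "valid_for_H n (\<lambda>S. (\<Sum>l=1..L. \<alpha> l * S (I l)) \<ge> (\<Sum>r=1..R. \<beta> r * S (J r)))"
  unfolding valid_for_H_def
proof
  fix S assume "S \<in> H n"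
  \<comment> \<open>\<open>M\<close> is the size of the graph and its sink vertex; \<open>N\<close>
    is only a label outside \<open>{1..n}\<close> and need not equal \<open>M\<close>.\<close>
  then obtain M w where M: "n < M" and w: "weight_map M w" and S: "realizes n M w S"
    by (auto simp: H_def)
  obtain f where f: "contraction_map L \<alpha> R \<beta> (A_dom L I) f"
    and f_occ: "\<And>i. i \<in> {1..n} \<union> {N} \<Longrightarrow> f (occurrence L I i) = occurrence R J i"
    using assms(11) by blast
  have I: "I l \<in> subsystems n" "I l \<subseteq> {1..n}" if "l \<in> {1..L}" for l
    using assms(4) that by (auto simp: subsystems_def)
  have J: "J r \<in> subsystems n" "J r \<subseteq> {1..n}" if "r \<in> {1..R}" for r
    using assms(5) that by (auto simp: subsystems_def)
  define W where "W l = least_min_cut M n w (I l)" for l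
  define g where "g v = f (occurrence L W v)" for v
  define U where "U r = {v \<in> {1..M}. g v r = 1}" for r
  have W_cut: "W l \<in> cut_sets M n (I l)" if "l \<in> {1..L}" for l
    using least_min_cut_is_min_cut[OF M I(2)[OF that]] by (simp add: W_def is_min_cut_def)
  have dom: "occurrence L W v \<in> A_dom L I" for v
  proof (rule occurrence_in_A_dom)
    fix k l assume "k \<in> {1..L}" "l \<in> {1..L}"
    then show "W k \<subseteq> W l" if "I k \<subseteq> I l"
      unfolding W_def using w M I(2) that by (intro least_min_cut_mono)
    show "W k \<inter> W l = {}" if "I k \<inter> I l = {}"
      unfolding W_def using w M I(2) \<open>k \<in> _\<close> \<open>l \<in> _\<close> that by (intro least_min_cut_disjoint)
  qed
  have "g v \<in> bits R" for v
    unfolding g_def using f dom by (auto simp: contraction_map_def)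
  then have occ_U: "occurrence R U v = g v" if "v \<in> {1..M}" for v
    unfolding U_def using that by (intro bits_eq_occurrence)
  \<comment> \<open>On \<open>{1..n}\<close> each \<open>W l\<close> has trace \<open>I l\<close>,
    so the prescribed values of \<open>f\<close> apply.\<close>
  have g_boundary: "g v = occurrence R J v" if "v \<in> {1..n}" for v
  proof -
    have "occurrence L W v = occurrence L I v"
      using W_cut that by (intro occurrence_cong) (unfold cut_sets_def, blast)
    then show ?thesis unfolding g_def using f_occ that by simp
  qed
  \<comment> \<open>The vertex \<open>M\<close> lies in no \<open>W l\<close> and the label
    \<open>N\<close> in no \<open>I l\<close>. Both vectors are therefore all-zero, which carries
    the condition on \<open>N\<close> over to \<open>M\<close>.\<close>
  have g_sink: "g M = occurrence R J N"
  proof -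
    have "occurrence L W M = occurrence L I N"
    proof (rule occurrence_cong)
      fix k assume k: "k \<in> {1..L}"
      have "M \<notin> W k" using W_cut[OF k] M by (force simp: cut_sets_def)
      moreover have "N \<notin> I k" using I(2)[OF k] assms(10) by blast
      ultimately show "M \<in> W k \<longleftrightarrow> N \<in> I k" by blast
    qed
    then show ?thesis unfolding g_def using f_occ by simp
  qed
  have U_cut: "U r \<in> cut_sets M n (J r)" if r: "r \<in> {1..R}" for r
  proof -
    \<comment> \<open>\<open>U r\<close> is drawn from all of \<open>{1..M}\<close>, so the sink has
      to be excluded; its bit is that of \<open>N\<close>, which is not in
      \<open>J r\<close>.\<close>
    have "M \<notin> U r"
      using J(2)[OF r] assms(10) r by (auto simp: U_def g_sink occurrence_def)
    then have "U r \<subseteq> {1..M} - {M}" unfolding U_def by blast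
    also have "\<dots> \<subseteq> {1..M - 1}" by auto
    finally have "U r \<subseteq> {1..M - 1}" .
    moreover have "v \<in> U r \<longleftrightarrow> v \<in> J r" if "v \<in> {1..n}" for v
      using that M r g_boundary[OF that] by (auto simp: U_def occurrence_def)
    ultimately show ?thesis using J(2)[OF r] unfolding cut_sets_def by blast
  qed
  \<comment> \<open>\<open>U r\<close> need not be a minimum cut for \<open>J r\<close>; being a
    competitor suffices for this direction. On the left-hand side of the inequality the cuts
    \<open>W l\<close> attain the minimum, so the last link of the chain is an equality.\<close>
  have "(\<Sum>r=1..R. \<beta> r * S (J r)) \<le> (\<Sum>r=1..R. \<beta> r * cut_weight M w (U r))"
    using assms(3) realizes_le_cut_weight[OF S J(1) U_cut]
    by (intro sum_mono mult_left_mono) (auto simp: less_imp_le)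
  also have "\<dots> \<le> (\<Sum>l=1..L. \<alpha> l * cut_weight M w (W l))"
    using w
  proof (rule sum_cut_weight_contraction)
    fix u v assume "u \<in> {1..M}" "v \<in> {1..M}"
    then show "wdist R \<beta> (occurrence R U u) (occurrence R U v)
        \<le> wdist L \<alpha> (occurrence L W u) (occurrence L W v)"
      using f dom by (simp only: occ_U g_def contraction_map_def)
  qed
  also have "\<dots> = (\<Sum>l=1..L. \<alpha> l * S (I l))"
    using realizes_least_min_cut[OF S I(1) M] by (intro sum.cong) (auto simp: W_def)
  finally show "(\<Sum>l=1..L. \<alpha> l * S (I l)) \<ge> (\<Sum>r=1..R. \<beta> r * S (J r))" .
qed

end
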